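(* Let $G$ be a torsion-free abelian group and let $R=\bigoplus_{x\in G}R_x$ be a $G$-graded commutative ring. If $R$ has a homogeneous element of nonzero degree which is a non-zero-divisor of $R$, then $R$ is quasi-Jacobson, i.e. the nilradical and the Jacobson radical of $R$ are equal.
   Context: Rings have an identity. A $G$-graded ring is a ring $R$ with a decomposition $R=\bigoplus_{n\in G}R_n$ of its additive group into subgroups with $R_mR_n\subseteq R_{m+n}$ for all $m,n\in G$. A homogeneous element of degree $n$ is a nonzero element of $R_n$. *)

theory Defs
  imports "HOL-Algebra.Algebra"
begin

definition torsion_free :: "('g, 'm) monoid_scheme \<Rightarrow> bool" where
  "torsion_free G \<longleftrightarrow>
     (\<forall>x\<in>carrier G. \<forall>n::nat. n > 0 \<longrightarrow> x [^]\<^bsub>G\<^esub> n = \<one>\<^bsub>G\<^esub> \<longrightarrow> x = \<one>\<^bsub>G\<^esub>)"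

text \<open>
  The grading group is an object of HOL-Algebra and hence written multiplicatively:
  the degree \<open>m + n\<close> of the mathematical text is \<open>m \<otimes>\<^bsub>G\<^esub> n\<close>, and degree \<open>0\<close> is \<open>\<one>\<^bsub>G\<^esub>\<close>.
  \<open>A x\<close> is the component of degree \<open>x\<close>. That the additive group of \<open>R\<close> is the internal
  direct sum of the components says that every element has a unique finitely supported
  family of homogeneous components; the families are extensional on \<open>carrier G\<close>, as
  otherwise uniqueness would fail for want of control outside the carrier.
\<close>

locale graded_ring = G: group G + ring R
  for G :: "('g, 'm) monoid_scheme" and R :: "('r, 'n) ring_scheme" (structure) +
  fixes A :: "'g \<Rightarrow> 'r set"
  assumes component_subgroup:
      "x \<in> carrier G \<Longrightarrow> additive_subgroup (A x) R"
    and direct_sum: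
      "r \<in> carrier R \<Longrightarrow>
        \<exists>!f. f \<in> (\<Pi>\<^sub>E x\<in>carrier G. A x) \<and> finite {x \<in> carrier G. f x \<noteq> \<zero>} \<and>
          r = (\<Oplus>x\<in>{x \<in> carrier G. f x \<noteq> \<zero>}. f x)"
    and component_mult:
      "\<lbrakk>x \<in> carrier G; y \<in> carrier G; a \<in> A x; b \<in> A y\<rbrakk> \<Longrightarrow> a \<otimes> b \<in> A (x \<otimes>\<^bsub>G\<^esub> y)"

definition homogeneous_of_degree ::
    "('g, 'm) monoid_scheme \<Rightarrow> ('r, 'n) ring_scheme \<Rightarrow> ('g \<Rightarrow> 'r set) \<Rightarrow> 'g \<Rightarrow> 'r \<Rightarrow> bool" where
  "homogeneous_of_degree G R A x a \<longleftrightarrow> x \<in> carrier G \<and> a \<in> A x \<and> a \<noteq> \<zero>\<^bsub>R\<^esub>"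

text \<open>The next four notions are meant for commutative rings only.\<close>

definition non_zero_divisor :: "('r, 'n) ring_scheme \<Rightarrow> 'r \<Rightarrow> bool" where
  "non_zero_divisor R a \<longleftrightarrow>
     a \<in> carrier R \<and> (\<forall>b\<in>carrier R. a \<otimes>\<^bsub>R\<^esub> b = \<zero>\<^bsub>R\<^esub> \<longrightarrow> b = \<zero>\<^bsub>R\<^esub>)"

definition nilradical :: "('r, 'n) ring_scheme \<Rightarrow> 'r set" where
  "nilradical R = {a \<in> carrier R. \<exists>n::nat. n > 0 \<and> a [^]\<^bsub>R\<^esub> n = \<zero>\<^bsub>R\<^esub>}"

definition jacobson_radical :: "('r, 'n) ring_scheme \<Rightarrow> 'r set" where
  "jacobson_radical R = {a \<in> carrier R. \<forall>M. maximalideal M R \<longrightarrow> a \<in> M}"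

definition quasi_jacobson :: "('r, 'n) ring_scheme \<Rightarrow> bool" where
  "quasi_jacobson R \<longleftrightarrow> nilradical R = jacobson_radical R"

end

theory Submission
  imports Defs
begin

text \<open>
  Let \<open>f\<close> lie in the Jacobson radical and let \<open>a\<close> be a homogeneous non-zero-divisor of degree
  \<open>x \<noteq> \<one>\<close>. As \<open>x\<close> has infinite order, \<open>h = a [^] k \<otimes> f\<close> has no component of degree \<open>\<one>\<close> for
  some \<open>k\<close>, and \<open>\<one> \<oplus> h\<close> is a unit whose component of degree \<open>\<one>\<close> is \<open>\<one>\<close>. The group can be
  ordered, so for a prime ideal \<open>P\<close>, homogeneous or not, the largest and the smallest degrees of
  components outside \<open>P\<close> add up in products. Those of a unit and its inverse therefore
  coincide, and all components of \<open>\<one> \<oplus> h\<close> of degree other than \<open>\<one>\<close> lie in \<open>P\<close>. Hence \<open>h\<close> lies in every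
  prime ideal and is nilpotent, and so is \<open>f\<close>. This avoids showing that the Jacobson
  radical is a homogeneous ideal.
\<close>

section \<open>Prime and maximal ideals\<close>

text \<open>Zorn's lemma: the union of a nonempty chain of ideals that miss \<open>S\<close> is
  again an ideal that misses \<open>S\<close>. Taking for \<open>S\<close> the powers of an element
  leads to prime ideals, taking \<open>{\<one>}\<close> leads to maximal ideals.\<close>

lemma (in ring) ideal_maximal_avoiding:
  assumes "ideal I R" "I \<inter> S = {}"
  shows "\<exists>P. ideal P R \<and> I \<subseteq> P \<and> P \<inter> S = {} \<and>
    (\<forall>J. ideal J R \<longrightarrow> P \<subseteq> J \<longrightarrow> J \<inter> S = {} \<longrightarrow> J = P)"
proof -
  let ?F = "{J. ideal J R \<and> I \<subseteq> J \<and> J \<inter> S = {}}"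
  have "\<exists>P\<in>?F. \<forall>J\<in>?F. P \<subseteq> J \<longrightarrow> J = P"
  proof (rule subset_Zorn_nonempty)
    show "?F \<noteq> {}" using assms by auto
    fix C assume C: "C \<noteq> {}" "subset.chain ?F C"
    then have "subset.chain {J. ideal J R} C"
      unfolding pred_on.chain_def by blast
    then have "ideal (\<Union>C) R"
      using chain_Union_is_ideal[of C] C(1) by simp
    moreover have "I \<subseteq> \<Union>C" "\<Union>C \<inter> S = {}"
      using C unfolding pred_on.chain_def by blast+
    ultimately show "\<Union>C \<in> ?F" by simp
  qed
  then obtain P where P: "ideal P R" "I \<subseteq> P" "P \<inter> S = {}"
    and "\<forall>J\<in>?F. P \<subseteq> J \<longrightarrow> J = P"
    by auto
  then have "\<forall>J. ideal J R \<longrightarrow> P \<subseteq> J \<longrightarrow> J \<inter> S = {} \<longrightarrow> J = P"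
    using P(2) by blast
  then show ?thesis using P by blast
qed

lemma (in ring) mem_add_cgenideal:
  "z \<in> P <+>\<^bsub>R\<^esub> PIdl x \<longleftrightarrow> (\<exists>p\<in>P. \<exists>r\<in>carrier R. z = p \<oplus> r \<otimes> x)"
  unfolding set_add_def' cgenideal_def by auto

text \<open>An ideal \<open>P\<close> maximal among those without powers of \<open>b\<close> is
  prime: if \<open>x\<close> and \<open>y\<close> lie outside \<open>P\<close>, then
  \<open>P + (x)\<close> and \<open>P + (y)\<close> both contain powers of \<open>b\<close>, and the
  product of these powers lies in \<open>P + (x \<otimes> y)\<close>. This yields nilpotence of an
  element from its membership in all prime ideals.\<close>

lemma (in cring) exists_prime_not_containing:
  assumes b: "b \<in> carrier R" and "b \<notin> nilradical R"
  obtains P where "primeideal P R" "b \<notin> P"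
proof -
  define S where "S = range (\<lambda>n::nat. b [^] n)"
  have power_mem: "b [^] n \<in> S" for n :: nat unfolding S_def by blast
  have mem_power: "\<exists>n::nat. x = b [^] n" if "x \<in> S" for x using that unfolding S_def by blast
  have nz: "b [^] n \<noteq> \<zero>" for n :: nat
  proof
    assume "b [^] n = \<zero>"
    \<comment> \<open>\<open>nilradical\<close> asks for a positive exponent; passing to
      \<open>Suc n\<close> covers \<open>n = 0\<close>, where the ring would be trivial.\<close>
    then have "b [^] Suc n = \<zero>" using b by simp
    then show False using assms unfolding nilradical_def by blast
  qed
  then have "\<zero> \<notin> S" using mem_power by metis
  then have "{\<zero>} \<inter> S = {}" by simp
  from ideal_maximal_avoiding[OF zeroideal this] obtain P where P: "ideal P R" "P \<inter> S = {}"
    and max: "\<forall>J. ideal J R \<longrightarrow> P \<subseteq> J \<longrightarrow> J \<inter> S = {} \<longrightarrow> J = P"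
    by (elim exE conjE)
  interpret P: ideal P R by fact
  have power: "\<exists>n::nat. \<exists>p\<in>P. \<exists>r\<in>carrier R. b [^] n = p \<oplus> r \<otimes> x"
    if x: "x \<in> carrier R" "x \<notin> P" for x
  proof -
    let ?J = "P <+>\<^bsub>R\<^esub> PIdl x"
    have J: "ideal ?J R" using add_ideals[OF P(1) cgenideal_ideal[OF x(1)]] .
    have sub: "P \<subseteq> ?J"
    proof
      fix p assume "p \<in> P"
      then have "p = p \<oplus> \<zero> \<otimes> x" using x by (simp add: P.Icarr)
      then show "p \<in> ?J"
        unfolding mem_add_cgenideal using \<open>p \<in> P\<close> by blast
    qed
    have "x = \<zero> \<oplus> \<one> \<otimes> x" using x by simp
    then have "x \<in> ?J"
      unfolding mem_add_cgenideal using P.zero_closed by blast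
    then have "?J \<inter> S \<noteq> {}" using max J sub x by blast
    then obtain n :: nat where "b [^] n \<in> ?J" using mem_power by blast
    then show ?thesis unfolding mem_add_cgenideal by blast
  qed
  have "primeideal P R"
  proof (rule primeidealI[OF P(1)])
    show "cring R" by (rule is_cring)
    have "\<one> \<in> S" using power_mem[of 0] by simp
    then show "carrier R \<noteq> P" using P(2) by blast
    fix x y assume xy: "x \<in> carrier R" "y \<in> carrier R" "x \<otimes> y \<in> P"
    show "x \<in> P \<or> y \<in> P"
    proof (rule ccontr)
      assume "\<not> (x \<in> P \<or> y \<in> P)"
      then obtain m n :: nat and p q r s where
        m: "p \<in> P" "r \<in> carrier R" "b [^] m = p \<oplus> r \<otimes> x" and
        n: "q \<in> P" "s \<in> carrier R" "b [^] n = q \<oplus> s \<otimes> y"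
        using power xy by meson
      have pq: "p \<in> carrier R" "q \<in> carrier R" using m n P.Icarr by auto
      have "b [^] (m + n) = (p \<oplus> r \<otimes> x) \<otimes> (q \<oplus> s \<otimes> y)"
        using b m n by (metis nat_pow_mult)
      also have "\<dots> = p \<otimes> (q \<oplus> s \<otimes> y) \<oplus> (r \<otimes> x) \<otimes> q \<oplus> (r \<otimes> s) \<otimes> (x \<otimes> y)"
        using m n pq xy by algebra
      also have "\<dots> \<in> P"
      proof -
        have "p \<otimes> (q \<oplus> s \<otimes> y) \<in> P" using m n pq xy by (intro P.I_r_closed) auto
        moreover have "(r \<otimes> x) \<otimes> q \<in> P" using m n xy by (intro P.I_l_closed) auto
        moreover have "(r \<otimes> s) \<otimes> (x \<otimes> y) \<in> P" using m n xy by (simp add: P.I_l_closed)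
        ultimately show ?thesis
          by (intro additive_subgroup.a_closed[OF P.is_additive_subgroup])
      qed
      finally show False using P(2) power_mem by blast
    qed
  qed
  moreover have "b \<in> S" using power_mem[of 1] nat_pow_eone[OF b] by simp
  then have "b \<notin> P" using P(2) by blast
  ultimately show thesis by (rule that)
qed

text \<open>Otherwise \<open>\<one> \<oplus> r \<otimes> f\<close> generates a proper ideal and lies
  in some maximal ideal. That ideal contains \<open>r \<otimes> f\<close> as well, hence also
  \<open>\<one>\<close>.\<close>

lemma (in cring) jacobson_one_plus_mult_invertible:
  assumes f: "f \<in> jacobson_radical R" and r: "r \<in> carrier R"
  obtains v where "v \<in> carrier R" "(\<one> \<oplus> r \<otimes> f) \<otimes> v = \<one>"
proof -
  have fc: "f \<in> carrier R" using f unfolding jacobson_radical_def by simp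
  let ?u = "\<one> \<oplus> r \<otimes> f"
  have u: "?u \<in> carrier R" using fc r by simp
  have "\<one> \<in> PIdl ?u"
  proof (rule ccontr)
    assume "\<one> \<notin> PIdl ?u"
    \<comment> \<open>An ideal is proper exactly if it misses \<open>{\<one>}\<close>, so an ideal
      maximal with this property is a maximal ideal.\<close>
    then have "PIdl ?u \<inter> {\<one>} = {}" by simp
    from ideal_maximal_avoiding[OF cgenideal_ideal[OF u] this] obtain P where
      P: "ideal P R" "PIdl ?u \<subseteq> P" "P \<inter> {\<one>} = {}"
      and max: "\<forall>J. ideal J R \<longrightarrow> P \<subseteq> J \<longrightarrow> J \<inter> {\<one>} = {} \<longrightarrow> J = P"
      by (elim exE conjE)
    interpret P: ideal P R by fact
    have "maximalideal P R"
    proof (rule maximalidealI[OF P(1)])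
      show "carrier R \<noteq> P" using P(3) by auto
      fix J assume J: "ideal J R" "P \<subseteq> J" "J \<subseteq> carrier R"
      show "J = P \<or> J = carrier R"
        using max J(1,2) ideal.one_imp_carrier[OF J(1)] by blast
    qed
    then have "f \<in> P" using f unfolding jacobson_radical_def by simp
    then have "r \<otimes> f \<in> P" using r by (rule P.I_l_closed)
    moreover have "?u \<in> P" using P(2) cgenideal_self[OF u] by blast
    ultimately have "?u \<ominus> r \<otimes> f \<in> P"
      unfolding a_minus_def
      using additive_subgroup.a_closed additive_subgroup.a_inv_closed P.is_additive_subgroup by metis
    moreover have "?u \<ominus> r \<otimes> f = \<one>" using r fc by algebra
    ultimately show False using P(3) by simp
  qed
  then obtain v where "v \<in> carrier R" "\<one> = v \<otimes> ?u"
    unfolding cgenideal_def by auto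
  then show thesis using that u by (metis m_comm)
qed

lemma (in primeideal) mem_of_power_mem:
  assumes "a \<in> carrier R" "a [^] (n::nat) \<in> I"
  shows "a \<in> I"
  using assms(2)
proof (induction n)
  case 0
  then show ?case using one_imp_carrier I_notcarr by simp
next
  case (Suc n)
  then show ?case using I_prime[of "a [^] n" a] assms(1) by auto
qed

lemma (in cring) nilradical_subset_jacobson_radical:
  "nilradical R \<subseteq> jacobson_radical R"
proof
  fix a assume "a \<in> nilradical R"
  then obtain n :: nat where a: "a \<in> carrier R" "a [^] n = \<zero>"
    unfolding nilradical_def by auto
  have "a \<in> M" if "maximalideal M R" for M
  proof -
    interpret primeideal M R using maximalideal_prime[OF that] .
    show ?thesis using mem_of_power_mem[of a n] a zero_closed by simp
  qed
  then show "a \<in> jacobson_radical R" using a unfolding jacobson_radical_def by simp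
qed

text \<open>The factors \<open>a\<close> are cancelled one at a time. At the end this removes the
  power of \<open>a\<close> by which \<open>f\<close> was multiplied.\<close>

lemma (in cring) power_mult_eq_zero_imp:
  assumes "non_zero_divisor R a" "b \<in> carrier R" "a [^] (k::nat) \<otimes> b = \<zero>"
  shows "b = \<zero>"
  using assms(3)
proof (induction k)
  case 0
  then show ?case using assms by simp
next
  case (Suc k)
  have a: "a \<in> carrier R" using assms unfolding non_zero_divisor_def by simp
  have "a \<otimes> (a [^] k \<otimes> b) = \<zero>"
    using Suc.prems a assms(2) by (simp add: m_ac)
  moreover have "a [^] k \<otimes> b \<in> carrier R" using a assms(2) by simp
  ultimately have "a [^] k \<otimes> b = \<zero>" using assms(1) unfolding non_zero_divisor_def by blast
  then show ?case by (rule Suc.IH)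
qed

section \<open>Sums and membership in an ideal\<close>

lemma (in ideal) finsum_mem:
  assumes "\<And>i. i \<in> F \<Longrightarrow> g i \<in> I"
  shows "(\<Oplus>i\<in>F. g i) \<in> I"
  using assms
proof (induction F rule: infinite_finite_induct)
  case (insert x F)
  then have "g \<in> F \<rightarrow> carrier R" "g x \<in> carrier R" using Icarr by auto
  then show ?case using insert by (simp add: a_closed)
qed auto

text \<open>Subtracting the other summands from a sum in \<open>I\<close> would put
  \<open>g j\<close> into \<open>I\<close>. This is how a single leading term is detected modulo a
  prime ideal.\<close>

lemma (in ideal) finsum_not_mem:
  assumes "finite F" "j \<in> F" "g j \<in> carrier R" "g j \<notin> I"
    and "\<And>i. \<lbrakk>i \<in> F; i \<noteq> j\<rbrakk> \<Longrightarrow> g i \<in> I"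
  shows "(\<Oplus>i\<in>F. g i) \<notin> I"
proof
  assume *: "(\<Oplus>i\<in>F. g i) \<in> I"
  let ?s = "\<Oplus>i\<in>F - {j}. g i"
  have s: "?s \<in> I" using assms by (intro finsum_mem) auto
  have F: "F = insert j (F - {j})" using assms by blast
  have "(\<Oplus>i\<in>F. g i) = g j \<oplus> ?s"
    by (subst F, subst finsum_insert) (use assms Icarr in auto)
  then have "g j = (\<Oplus>i\<in>F. g i) \<ominus> ?s"
    using assms(3) Icarr[OF s] by algebra
  then show False
    using * s assms(4) a_subgroup additive_subgroup.a_closed additive_subgroup.a_inv_closed is_additive_subgroup
    unfolding a_minus_def by metis
qed

section \<open>Torsion-free abelian groups are orderable\<close>

lemma torsion_freeD:
  "\<lbrakk>torsion_free G; x \<in> carrier G; (n::nat) > 0; x [^]\<^bsub>G\<^esub> n = \<one>\<^bsub>G\<^esub>\<rbrakk> \<Longrightarrow> x = \<one>\<^bsub>G\<^esub>"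
  unfolding torsion_free_def by blast

text \<open>Such a set consists of the elements that are at least \<open>\<one>\<close> in a
  translation-invariant partial order, where \<open>x\<close> is below \<open>y\<close> if
  \<open>y \<otimes> inv x\<close> lies in the set. The order need not be total.\<close>

definition (in comm_group) positive_cone :: "'a set \<Rightarrow> bool" where
  "positive_cone P \<longleftrightarrow> submonoid P G \<and> (\<forall>x\<in>P. inv x \<in> P \<longrightarrow> x = \<one>)"

text \<open>Both conditions on a cone involve at most two elements at a time, and two elements of
  the union lie in a common member of the chain.\<close>

lemma (in comm_group) positive_cone_Union:
  assumes "C \<noteq> {}" "subset.chain (Collect positive_cone) C"
  shows "positive_cone (\<Union>C)"
proof -
  have cone: "submonoid Q G" "\<And>x. \<lbrakk>x \<in> Q; inv x \<in> Q\<rbrakk> \<Longrightarrow> x = \<one>" if "Q \<in> C" for Q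
    using assms(2) that unfolding pred_on.chain_def positive_cone_def by auto
  have common: "\<exists>Q\<in>C. x \<in> Q \<and> y \<in> Q" if xy: "x \<in> \<Union>C" "y \<in> \<Union>C" for x y
  proof -
    obtain Q1 Q2 where Q: "Q1 \<in> C" "x \<in> Q1" "Q2 \<in> C" "y \<in> Q2" using xy by blast
    then have "Q1 \<subseteq> Q2 \<or> Q2 \<subseteq> Q1"
      using assms(2) unfolding pred_on.chain_def by blast
    then show ?thesis using Q by blast
  qed
  have "submonoid (\<Union>C) G"
  proof
    show "\<Union>C \<subseteq> carrier G" using cone(1) submonoid.subset by blast
    show "\<one> \<in> \<Union>C" using assms(1) cone(1) submonoid.one_closed by blast
    fix x y assume "x \<in> \<Union>C" "y \<in> \<Union>C"
    then obtain Q where Q: "Q \<in> C" "x \<in> Q" "y \<in> Q" using common by blast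
    then have "x \<otimes> y \<in> Q" by (intro submonoid.m_closed[OF cone(1)])
    then show "x \<otimes> y \<in> \<Union>C" using Q(1) by blast
  qed
  moreover have "x = \<one>" if "x \<in> \<Union>C" "inv x \<in> \<Union>C" for x
    using common[OF that] cone(2) by blast
  ultimately show ?thesis unfolding positive_cone_def by blast
qed

text \<open>If \<open>x = p \<otimes> g [^] m\<close> and
  \<open>inv x = q \<otimes> g [^] n\<close>, then \<open>p \<otimes> q\<close> is the inverse of
  \<open>g [^] (m + n)\<close>. By \<open>neg\<close> this forces \<open>m = n = 0\<close>, so
  \<open>x\<close> and \<open>inv x\<close> already lie in \<open>P\<close>.\<close>

lemma (in comm_group) positive_cone_extend:
  assumes P: "positive_cone P" and g: "g \<in> carrier G"
    and neg: "\<And>n::nat. n > 0 \<Longrightarrow> inv (g [^] n) \<notin> P"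
  shows "positive_cone {p \<otimes> g [^] n | p (n::nat). p \<in> P}" (is "positive_cone ?Q")
proof -
  interpret P: submonoid P G using P unfolding positive_cone_def by simp
  have c: "p \<in> carrier G" if "p \<in> P" for p using P.subset that by blast
  have "submonoid ?Q G"
  proof
    show "?Q \<subseteq> carrier G" using c g by auto
    have "\<one> = \<one> \<otimes> g [^] (0::nat)" by simp
    then show "\<one> \<in> ?Q" using P.one_closed by blast
    fix x y assume "x \<in> ?Q" "y \<in> ?Q"
    then obtain p q and m n :: nat where
      pq: "p \<in> P" "q \<in> P" "x = p \<otimes> g [^] m" "y = q \<otimes> g [^] n" by blast
    then have "x \<otimes> y = (p \<otimes> q) \<otimes> (g [^] m \<otimes> g [^] n)"
      using c g by (simp add: m_ac)
    then have "x \<otimes> y = (p \<otimes> q) \<otimes> g [^] (m + n)"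
      using g by (simp add: nat_pow_mult)
    then show "x \<otimes> y \<in> ?Q" using P.m_closed[OF pq(1,2)] by blast
  qed
  moreover have "x = \<one>" if x: "x \<in> ?Q" "inv x \<in> ?Q" for x
  proof -
    obtain p q and m n :: nat where
      pq: "p \<in> P" "q \<in> P" and xp: "x = p \<otimes> g [^] m" and xq: "inv x = q \<otimes> g [^] n"
      using x by blast
    have xc: "x \<in> carrier G" using pq xp c g by simp
    have "(p \<otimes> q) \<otimes> g [^] (m + n) = (p \<otimes> g [^] m) \<otimes> (q \<otimes> g [^] n)"
      using pq c g by (simp add: m_ac nat_pow_mult[symmetric])
    also have "\<dots> = \<one>" using xp xq xc by (metis r_inv)
    finally have one: "(p \<otimes> q) \<otimes> g [^] (m + n) = \<one>" .
    then have "p \<otimes> q = inv (g [^] (m + n))"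
      using pq c g by (metis P.m_closed inv_equality inv_inv nat_pow_closed)
    then have "\<not> m + n > 0" using neg P.m_closed pq by metis
    then have mn: "m = 0" "n = 0" by auto
    then have "x = p" "inv x = q" using xp xq pq c by simp_all
    then show "x = \<one>" using P pq unfolding positive_cone_def by blast
  qed
  ultimately show ?thesis unfolding positive_cone_def by blast
qed

text \<open>A maximal cone is total. If it contained neither \<open>x\<close> nor
  \<open>inv x\<close>, neither could be adjoined, so it would contain \<open>inv (x [^] m)\<close>
  and \<open>x [^] n\<close> with \<open>m\<close> and \<open>n\<close> positive. Then
  \<open>x [^] (n * m)\<close> and its inverse both lie in the cone, so this power is
  \<open>\<one>\<close>, and torsion-freeness gives \<open>x = \<one>\<close>.\<close>

lemma (in comm_group) total_positive_cone:
  assumes tf: "torsion_free G"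
  obtains P where "positive_cone P" "\<And>x. x \<in> carrier G \<Longrightarrow> x \<in> P \<or> inv x \<in> P"
proof -
  have "\<exists>P\<in>Collect positive_cone. \<forall>Q\<in>Collect positive_cone. P \<subseteq> Q \<longrightarrow> Q = P"
  proof (rule subset_Zorn_nonempty)
    have "positive_cone {\<one>}" unfolding positive_cone_def by (auto intro: submonoid.intro)
    then show "Collect positive_cone \<noteq> {}" by blast
  qed (use positive_cone_Union in blast)
  then obtain P where P: "positive_cone P" and max: "\<And>Q. positive_cone Q \<Longrightarrow> P \<subseteq> Q \<Longrightarrow> Q = P"
    by blast
  interpret P: submonoid P G using P unfolding positive_cone_def by simp
  have c: "p \<in> carrier G" if "p \<in> P" for p using P.subset that by blast
  \<comment> \<open>By maximality, an element that can be adjoined is already there.\<close>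
  have mem: "g \<in> P" if g: "g \<in> carrier G" and neg: "\<And>n::nat. n > 0 \<Longrightarrow> inv (g [^] n) \<notin> P" for g
  proof -
    let ?Q = "{p \<otimes> g [^] n | p (n::nat). p \<in> P}"
    have sub: "P \<subseteq> ?Q"
    proof
      fix p assume p: "p \<in> P"
      then have "p = p \<otimes> g [^] (0::nat)" using c by simp
      then show "p \<in> ?Q" using p by blast
    qed
    have "g = \<one> \<otimes> g [^] (1::nat)" using g by simp
    then have "g \<in> ?Q" using P.one_closed by blast
    moreover have "?Q = P" by (rule max[OF positive_cone_extend[OF P g neg] sub])
    ultimately show ?thesis by blast
  qed
  have powP: "x [^] (n::nat) \<in> P" if "x \<in> P" for x n
    by (induction n) (use that in auto)
  have "x \<in> P \<or> inv x \<in> P" if x: "x \<in> carrier G" for x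
  proof (rule ccontr)
    assume "\<not> (x \<in> P \<or> inv x \<in> P)"
    then obtain m n :: nat where m: "m > 0" "inv (x [^] m) \<in> P"
      and n: "n > 0" "inv (inv x [^] n) \<in> P"
      using mem[of x] mem[of "inv x"] x inv_closed by metis
    have "x [^] n \<in> P" using n(2) x by (simp add: nat_pow_inv)
    then have "(x [^] n) [^] m \<in> P" by (rule powP)
    then have 1: "x [^] (n * m) \<in> P" using x by (simp add: nat_pow_pow)
    have "(inv (x [^] m)) [^] n \<in> P" using m(2) by (rule powP)
    then have 2: "inv (x [^] (n * m)) \<in> P"
      using x by (simp add: nat_pow_inv nat_pow_pow mult.commute)
    have "x [^] (n * m) = \<one>" using P 1 2 unfolding positive_cone_def by blast
    then have "x = \<one>" using tf x m(1) n(1) by (metis torsion_freeD nat_0_less_mult_iff)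
    then show False using \<open>\<not> (x \<in> P \<or> inv x \<in> P)\<close> P.one_closed by blast
  qed
  then show thesis using that P by blast
qed

text \<open>The strict order is a parameter, constrained only on the carrier, so that the reversed
  order is simply another instance.\<close>

locale ordered_group_rel = G: comm_group G for G (structure) +
  fixes lt :: "'a \<Rightarrow> 'a \<Rightarrow> bool" (infix "\<^bold><" 50)
  assumes irrefl: "x \<in> carrier G \<Longrightarrow> \<not> x \<^bold>< x"
    and trans: "\<lbrakk>x \<in> carrier G; y \<in> carrier G; z \<in> carrier G; x \<^bold>< y; y \<^bold>< z\<rbrakk> \<Longrightarrow> x \<^bold>< z"
    and total: "\<lbrakk>x \<in> carrier G; y \<in> carrier G\<rbrakk> \<Longrightarrow> x \<^bold>< y \<or> x = y \<or> y \<^bold>< x"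
    and mult_mono: "\<lbrakk>x \<in> carrier G; y \<in> carrier G; z \<in> carrier G; x \<^bold>< y\<rbrakk> \<Longrightarrow> x \<otimes> z \<^bold>< y \<otimes> z"
begin

text \<open>Turns a statement about largest degrees into one about smallest degrees.\<close>

lemma converse: "ordered_group_rel G (\<lambda>x y. y \<^bold>< x)"
proof
  fix x y z assume c: "x \<in> carrier G" "y \<in> carrier G"
  show "\<not> x \<^bold>< x" using irrefl[OF c(1)] .
  show "y \<^bold>< x \<or> x = y \<or> x \<^bold>< y" using total[OF c] by blast
  assume z: "z \<in> carrier G"
  show "z \<^bold>< x" if "y \<^bold>< x" "z \<^bold>< y" using trans[OF z c(2) c(1) that(2) that(1)] .
  show "y \<otimes> z \<^bold>< x \<otimes> z" if "y \<^bold>< x" using mult_mono[OF c(2) c(1) z that] .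
qed

lemma finite_max:
  assumes "finite S" "S \<noteq> {}" "S \<subseteq> carrier G"
  shows "\<exists>m\<in>S. \<forall>x\<in>S. x = m \<or> x \<^bold>< m"
  using assms
proof (induction S rule: finite_ne_induct)
  case (insert x S)
  then obtain m where m: "m \<in> S" "\<forall>y\<in>S. y = m \<or> y \<^bold>< m" by auto
  have c: "x \<in> carrier G" "m \<in> carrier G" "S \<subseteq> carrier G" using insert m by auto
  consider "m \<^bold>< x" | "x = m \<or> x \<^bold>< m" using total c by blast
  then show ?case
  proof cases
    case 1
    have "y \<^bold>< x" if y: "y \<in> S" for y
    proof -
      have "y \<in> carrier G" using y c by blast
      then show ?thesis using trans[OF _ c(2,1) _ 1] m(2) y 1 by metis
    qed
    then show ?thesis by blast
  next
    case 2
    then show ?thesis using m by blast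
  qed
qed simp

text \<open>The comparison passes through \<open>s \<otimes> y\<close>. It shows that the product of
  two maxima is attained by no other pair, which isolates the leading term of a product.\<close>

lemma mult_strict_mono:
  assumes "x \<in> carrier G" "y \<in> carrier G" "s \<in> carrier G" "t \<in> carrier G"
    and "x = s \<or> x \<^bold>< s" "y = t \<or> y \<^bold>< t" "x \<noteq> s \<or> y \<noteq> t"
  shows "x \<otimes> y \<^bold>< s \<otimes> t"
proof -
  have l: "x \<otimes> y \<^bold>< s \<otimes> y" if "x \<^bold>< s" using mult_mono assms(1-4) that by simp
  have r: "s \<otimes> y \<^bold>< s \<otimes> t" if "y \<^bold>< t"
    using mult_mono[of y t s] assms(1-4) that by (simp add: G.m_comm)
  show ?thesis
    using l r trans[of "x \<otimes> y" "s \<otimes> y" "s \<otimes> t"] assms by (metis G.m_closed)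
qed

end

text \<open>A total cone defines the order: \<open>y\<close> exceeds \<open>x\<close> if
  \<open>y \<otimes> inv x\<close> is in the cone and differs from \<open>\<one>\<close>.\<close>

lemma (in comm_group) torsion_free_orderable:
  assumes "torsion_free G"
  obtains lt where "ordered_group_rel G lt"
proof -
  obtain P where P: "positive_cone P" and tot: "\<And>x. x \<in> carrier G \<Longrightarrow> x \<in> P \<or> inv x \<in> P"
    using total_positive_cone[OF assms] by blast
  interpret P: submonoid P G using P unfolding positive_cone_def by simp
  define lt where "lt x y \<longleftrightarrow> x \<noteq> y \<and> y \<otimes> inv x \<in> P" for x y
  have anti: "x = y" if "x \<in> carrier G" "y \<in> carrier G" "y \<otimes> inv x \<in> P" "x \<otimes> inv y \<in> P" for x y
  proof -
    have "inv (y \<otimes> inv x) = x \<otimes> inv y" using that by (simp add: inv_mult_group)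
    then have "y \<otimes> inv x = \<one>" using P that unfolding positive_cone_def by metis
    then show ?thesis using that by (metis inv_closed inv_equality inv_inv)
  qed
  have "ordered_group_rel G lt"
  proof
    fix x assume "x \<in> carrier G" then show "\<not> lt x x" unfolding lt_def by simp
  next
    fix x y z assume c: "x \<in> carrier G" "y \<in> carrier G" "z \<in> carrier G" and l: "lt x y" "lt y z"
    have "inv y \<otimes> (y \<otimes> inv x) = inv x" using c by (metis m_assoc l_inv l_one inv_closed)
    then have e: "(z \<otimes> inv y) \<otimes> (y \<otimes> inv x) = z \<otimes> inv x" using c by (simp add: m_assoc)
    have "z \<otimes> inv x \<in> P" using l P.m_closed unfolding lt_def e[symmetric] by blast
    \<comment> \<open>If \<open>x = z\<close>, then \<open>x\<close> and \<open>y\<close> would be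
      below each other.\<close>
    moreover have "x \<noteq> z" using anti[of x y] l c unfolding lt_def by blast
    ultimately show "lt x z" unfolding lt_def by blast
  next
    fix x y assume c: "x \<in> carrier G" "y \<in> carrier G"
    have "inv (y \<otimes> inv x) = x \<otimes> inv y" using c by (simp add: inv_mult_group)
    then show "lt x y \<or> x = y \<or> lt y x"
      using tot[of "y \<otimes> inv x"] c unfolding lt_def by auto
  next
    fix x y z assume c: "x \<in> carrier G" "y \<in> carrier G" "z \<in> carrier G" and l: "lt x y"
    have "z \<otimes> (inv z \<otimes> inv x) = inv x" using c by (metis m_assoc r_inv l_one inv_closed)
    then have "(y \<otimes> z) \<otimes> inv (x \<otimes> z) = y \<otimes> inv x"
      using c by (simp add: inv_mult_group m_assoc)
    moreover have "x \<otimes> z \<noteq> y \<otimes> z" using l c unfolding lt_def by simp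
    ultimately show "lt (x \<otimes> z) (y \<otimes> z)" using l unfolding lt_def by simp
  qed
  then show thesis by (rule that)
qed

section \<open>Homogeneous components\<close>

context graded_ring
begin

text \<open>For \<open>r\<close> in \<open>carrier R\<close> the description is definite by
  \<open>direct_sum\<close>.\<close>

definition component :: "'r \<Rightarrow> 'g \<Rightarrow> 'r" where
  "component r = (THE f. f \<in> (\<Pi>\<^sub>E x\<in>carrier G. A x) \<and> finite {x \<in> carrier G. f x \<noteq> \<zero>} \<and>
     r = (\<Oplus>x\<in>{x \<in> carrier G. f x \<noteq> \<zero>}. f x))"

definition degrees :: "'r \<Rightarrow> 'g set" where
  "degrees r = {x \<in> carrier G. component r x \<noteq> \<zero>}"

lemma homogeneous_carrier: "\<lbrakk>x \<in> carrier G; a \<in> A x\<rbrakk> \<Longrightarrow> a \<in> carrier R"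
  using additive_subgroup.a_Hcarr[OF component_subgroup] .

lemma
  assumes "r \<in> carrier R"
  shows component_mem: "x \<in> carrier G \<Longrightarrow> component r x \<in> A x"
    and finite_degrees: "finite (degrees r)"
    and sum_components: "r = (\<Oplus>x\<in>degrees r. component r x)"
proof -
  have "component r \<in> (\<Pi>\<^sub>E x\<in>carrier G. A x) \<and> finite {x \<in> carrier G. component r x \<noteq> \<zero>} \<and>
     r = (\<Oplus>x\<in>{x \<in> carrier G. component r x \<noteq> \<zero>}. component r x)"
    unfolding component_def by (rule theI'[OF direct_sum[OF assms]])
  then show "x \<in> carrier G \<Longrightarrow> component r x \<in> A x" "finite (degrees r)"
    "r = (\<Oplus>x\<in>degrees r. component r x)"
    unfolding degrees_def by (auto dest: PiE_mem)
qed

lemma degrees_subset: "degrees r \<subseteq> carrier G"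
  unfolding degrees_def by blast

lemma component_carrier: "\<lbrakk>r \<in> carrier R; x \<in> carrier G\<rbrakk> \<Longrightarrow> component r x \<in> carrier R"
  using component_mem homogeneous_carrier by blast

text \<open>Allows the decompositions of several elements to be written over one common index
  set.\<close>

lemma sum_components_superset:
  assumes "r \<in> carrier R" "finite F" "degrees r \<subseteq> F" "F \<subseteq> carrier G"
  shows "r = (\<Oplus>x\<in>F. component r x)"
proof -
  have "(\<Oplus>x\<in>degrees r. component r x) = (\<Oplus>x\<in>F. component r x)"
    using assms component_carrier
    by (intro add.finprod_mono_neutral_cong_left) (auto simp: degrees_def)
  then show ?thesis using sum_components[OF assms(1)] by simp
qed

text \<open>Extending \<open>g\<close> by zero to an extensional family on \<open>carrier G\<close>
  brings it under the uniqueness in \<open>direct_sum\<close>.\<close>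

lemma component_unique:
  assumes F: "finite F" "F \<subseteq> carrier G" and g: "\<And>x. x \<in> F \<Longrightarrow> g x \<in> A x"
    and r: "r = (\<Oplus>x\<in>F. g x)" and x: "x \<in> carrier G"
  shows "component r x = (if x \<in> F then g x else \<zero>)"
proof -
  let ?f = "\<lambda>x\<in>carrier G. if x \<in> F then g x else \<zero>"
  have gc: "g y \<in> carrier R" if "y \<in> F" for y using that g F(2) homogeneous_carrier by blast
  have rc: "r \<in> carrier R" unfolding r using gc by (intro finsum_closed) auto
  have "?f \<in> (\<Pi>\<^sub>E x\<in>carrier G. A x)"
    using g additive_subgroup.zero_closed[OF component_subgroup] by auto
  \<comment> \<open>Only an inclusion, since \<open>g\<close> may vanish at points of
    \<open>F\<close>.\<close>
  moreover have sub: "{x \<in> carrier G. ?f x \<noteq> \<zero>} \<subseteq> F" by (auto split: if_splits)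
  moreover have "(\<Oplus>x\<in>{x \<in> carrier G. ?f x \<noteq> \<zero>}. ?f x) = (\<Oplus>x\<in>F. g x)"
    using F sub gc by (intro add.finprod_mono_neutral_cong_left) (auto split: if_splits)
  ultimately have "component r = ?f"
    unfolding component_def
    by (intro the1_equality[OF direct_sum[OF rc]]) (use F r finite_subset in auto)
  then show ?thesis using x by simp
qed

lemma component_homogeneous:
  assumes "x \<in> carrier G" "y \<in> carrier G" "a \<in> A x"
  shows "component a y = (if y = x then a else \<zero>)"
  using component_unique[of "{x}" "\<lambda>_. a" a y] assms homogeneous_carrier[OF assms(1,3)] by simp

lemma component_add:
  assumes r: "r \<in> carrier R" and s: "s \<in> carrier R" and x: "x \<in> carrier G"
  shows "component (r \<oplus> s) x = component r x \<oplus> component s x"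
proof -
  let ?F = "degrees r \<union> degrees s"
  have F: "finite ?F" "?F \<subseteq> carrier G" using finite_degrees r s degrees_subset by auto
  have "r \<oplus> s = (\<Oplus>x\<in>?F. component r x) \<oplus> (\<Oplus>x\<in>?F. component s x)"
    using sum_components_superset[OF r F(1) _ F(2)] sum_components_superset[OF s F(1) _ F(2)]
    by simp
  also have "\<dots> = (\<Oplus>x\<in>?F. component r x \<oplus> component s x)"
    by (rule finsum_addf[symmetric]) (use F r s component_carrier in auto)
  finally have "component (r \<oplus> s) x =
      (if x \<in> ?F then component r x \<oplus> component s x else \<zero>)"
    using r s x F
    by (intro component_unique) (auto intro!: additive_subgroup.a_closed[OF component_subgroup] component_mem)
  moreover have "component r x = \<zero>" "component s x = \<zero>" if "x \<notin> ?F"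
    using that x unfolding degrees_def by auto
  ultimately show ?thesis by simp
qed

lemma component_finsum:
  assumes "finite F" "\<And>i. i \<in> F \<Longrightarrow> g i \<in> carrier R" "x \<in> carrier G"
  shows "component (\<Oplus>i\<in>F. g i) x = (\<Oplus>i\<in>F. component (g i) x)"
  using assms(1,2)
proof (induction F rule: finite_induct)
  case empty
  have "\<zero> \<in> A x" using additive_subgroup.zero_closed[OF component_subgroup] assms(3) .
  then show ?case using component_homogeneous[of x x \<zero>] assms(3) by simp
next
  case (insert i F)
  then have "g \<in> F \<rightarrow> carrier R" "(\<lambda>i. component (g i) x) \<in> F \<rightarrow> carrier R"
    using assms(3) component_carrier by auto
  then show ?case
    using insert assms(3) component_carrier by (simp add: component_add)
qed

text \<open>The component \<open>?e\<close> of \<open>\<one>\<close> in neutral degree fixes every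
  homogeneous \<open>b\<close>: compare the components of \<open>\<one> \<otimes> b = b\<close> in
  the degree of \<open>b\<close>. So it fixes all components of \<open>\<one>\<close>, hence
  \<open>\<one>\<close> itself, and \<open>?e = \<one>\<close>.\<close>

lemma one_mem_component: "\<one> \<in> A \<one>\<^bsub>G\<^esub>"
proof -
  let ?e = "component \<one> \<one>\<^bsub>G\<^esub>"
  have e: "?e \<in> carrier R" "?e \<in> A \<one>\<^bsub>G\<^esub>" using component_carrier component_mem by simp_all
  have hom: "?e \<otimes> b = b" if y: "y \<in> carrier G" and b: "b \<in> A y" for b y
  proof -
    have bc: "b \<in> carrier R" using homogeneous_carrier y b .
    let ?g = "\<lambda>x. component (component \<one> x \<otimes> b) y"
    have mem: "component \<one> x \<otimes> b \<in> A (x \<otimes>\<^bsub>G\<^esub> y)" if "x \<in> carrier G" for x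
      using component_mult[OF that y component_mem[OF one_closed that] b] .
    have g: "?g x = (if x = \<one>\<^bsub>G\<^esub> then ?e \<otimes> b else \<zero>)" if "x \<in> carrier G" for x
    proof -
      have "y = x \<otimes>\<^bsub>G\<^esub> y \<longleftrightarrow> x = \<one>\<^bsub>G\<^esub>" using that y G.r_cancel_one' by metis
      then show ?thesis using component_homogeneous[OF _ y mem[OF that]] that y by simp
    qed
    \<comment> \<open>The neutral degree is inserted because it is not yet known that
      \<open>?e\<close> is nonzero.\<close>
    let ?F = "insert \<one>\<^bsub>G\<^esub> (degrees \<one>)"
    have F: "finite ?F" "?F \<subseteq> carrier G" using finite_degrees degrees_subset by auto
    have "\<one> = (\<Oplus>x\<in>?F. component \<one> x)"
      using sum_components_superset[OF one_closed F(1) _ F(2)] by blast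
    then have "b = (\<Oplus>x\<in>?F. component \<one> x) \<otimes> b" using bc by simp
    also have "\<dots> = (\<Oplus>x\<in>?F. component \<one> x \<otimes> b)"
      using F bc component_carrier by (intro finsum_ldistr) auto
    finally have "component b y = (\<Oplus>x\<in>?F. ?g x)"
      using component_finsum[OF F(1) _ y, of "\<lambda>x. component \<one> x \<otimes> b"] F(2) bc component_carrier
      by (metis (no_types, lifting) m_closed one_closed subset_iff)
    also have "\<dots> = (\<Oplus>x\<in>?F. if \<one>\<^bsub>G\<^esub> = x then ?e \<otimes> b else \<zero>)"
      using g F(2) e bc by (intro finsum_cong') auto
    also have "\<dots> = ?e \<otimes> b"
      using add.finprod_singleton[of "\<one>\<^bsub>G\<^esub>" ?F "\<lambda>_. ?e \<otimes> b"] F e bc by simp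
    finally show ?thesis using component_homogeneous[OF y y b] by simp
  qed
  have c: "x \<in> carrier G" "component \<one> x \<in> carrier R" if "x \<in> degrees \<one>" for x
    using that degrees_subset component_carrier one_closed by blast+
  have hom_component: "?e \<otimes> component \<one> x = component \<one> x" if "x \<in> degrees \<one>" for x
    using hom[OF c(1)[OF that] component_mem[OF one_closed c(1)[OF that]]] .
  have "?e \<otimes> \<one> = ?e \<otimes> (\<Oplus>x\<in>degrees \<one>. component \<one> x)"
    using sum_components[OF one_closed] by simp
  also have "\<dots> = (\<Oplus>x\<in>degrees \<one>. ?e \<otimes> component \<one> x)"
    using finite_degrees[OF one_closed] e c by (intro finsum_rdistr) auto
  also have "\<dots> = (\<Oplus>x\<in>degrees \<one>. component \<one> x)"
    using hom_component c by (intro finsum_cong') auto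
  also have "\<dots> = \<one>" using sum_components[OF one_closed] by (rule sym)
  finally show ?thesis using e by simp
qed

end

section \<open>Units of graded rings\<close>

context graded_ring
begin

text \<open>The convolution formula for products. With the degree condition inside the sums, both
  range over fixed index sets, so that \<open>finsum_not_mem\<close> can be applied to the inner and
  then to the outer sum.\<close>

lemma component_mult_expand:
  assumes u: "u \<in> carrier R" and v: "v \<in> carrier R" and z: "z \<in> carrier G"
    and E: "finite E" "degrees u \<subseteq> E" "E \<subseteq> carrier G"
    and F: "finite F" "degrees v \<subseteq> F" "F \<subseteq> carrier G"
  shows "component (u \<otimes> v) z =
    (\<Oplus>x\<in>E. \<Oplus>y\<in>F. if x \<otimes>\<^bsub>G\<^esub> y = z then component u x \<otimes> component v y else \<zero>)"
proof -
  have c: "component u x \<in> carrier R" "component v y \<in> carrier R" "x \<in> carrier G" "y \<in> carrier G"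
    if "x \<in> E" "y \<in> F" for x y
    using that u v E F component_carrier by blast+
  have inner: "component (component u x \<otimes> v) z =
      (\<Oplus>y\<in>F. if x \<otimes>\<^bsub>G\<^esub> y = z then component u x \<otimes> component v y else \<zero>)" if x: "x \<in> E" for x
  proof -
    have xG: "x \<in> carrier G" and ux: "component u x \<in> carrier R"
      using x E u component_carrier by blast+
    have "component u x \<otimes> v = component u x \<otimes> (\<Oplus>y\<in>F. component v y)"
      using sum_components_superset[OF v F] by simp
    also have "\<dots> = (\<Oplus>y\<in>F. component u x \<otimes> component v y)"
      using F ux x c by (intro finsum_rdistr) auto
    finally have "component (component u x \<otimes> v) z = (\<Oplus>y\<in>F. component (component u x \<otimes> component v y) z)"
      using component_finsum[OF F(1) _ z] x c by simp
    also have "\<dots> = (\<Oplus>y\<in>F. if x \<otimes>\<^bsub>G\<^esub> y = z then component u x \<otimes> component v y else \<zero>)"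
    proof (intro finsum_cong' refl)
      fix y assume y: "y \<in> F"
      then have "component u x \<otimes> component v y \<in> A (x \<otimes>\<^bsub>G\<^esub> y)"
        using component_mult component_mem u v c[OF x y] by simp
      from component_homogeneous[OF G.m_closed[OF c(3,4)[OF x y]] z this] show "component (component u x \<otimes> component v y) z =
          (if x \<otimes>\<^bsub>G\<^esub> y = z then component u x \<otimes> component v y else \<zero>)" by auto
    qed (use x c in auto)
    finally show ?thesis .
  qed
  have uv: "component u x \<otimes> v \<in> carrier R" if "x \<in> E" for x
    using that u v E component_carrier by blast
  have "u \<otimes> v = (\<Oplus>x\<in>E. component u x) \<otimes> v"
    using sum_components_superset[OF u E] by simp
  also have "\<dots> = (\<Oplus>x\<in>E. component u x \<otimes> v)"
    using E u v component_carrier by (intro finsum_ldistr) auto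
  finally have "component (u \<otimes> v) z = (\<Oplus>x\<in>E. component (component u x \<otimes> v) z)"
    using component_finsum[OF E(1) _ z, of "\<lambda>x. component u x \<otimes> v"] uv by simp
  also have "\<dots> = (\<Oplus>x\<in>E. \<Oplus>y\<in>F. if x \<otimes>\<^bsub>G\<^esub> y = z then component u x \<otimes> component v y else \<zero>)"
    using inner c by (intro finsum_cong' refl) (auto intro!: finsum_closed)
  finally show ?thesis .
qed

lemma component_one: "x \<in> carrier G \<Longrightarrow> component \<one> x = (if x = \<one>\<^bsub>G\<^esub> then \<one> else \<zero>)"
  using component_homogeneous[OF _ _ one_mem_component] by simp

text \<open>The product of the leading terms modulo \<open>P\<close> is the only term of its degree in \<open>u \<otimes> v = \<one>\<close>
  that is not in \<open>P\<close>, so that degree is that of \<open>\<one>\<close>.\<close>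

lemma leading_degrees_mod_prime:
  assumes ord: "ordered_group_rel G lt" and P: "primeideal P R"
    and u: "u \<in> carrier R" and v: "v \<in> carrier R" and uv: "u \<otimes> v = \<one>"
  defines "S \<equiv> {x \<in> carrier G. component u x \<notin> P}"
    and "T \<equiv> {y \<in> carrier G. component v y \<notin> P}"
  obtains s t where "s \<in> S" "t \<in> T" "s \<otimes>\<^bsub>G\<^esub> t = \<one>\<^bsub>G\<^esub>"
    "\<forall>x\<in>S. x = s \<or> lt x s" "\<forall>y\<in>T. y = t \<or> lt y t"
proof -
  interpret O: ordered_group_rel G lt by fact
  interpret P: primeideal P R by fact
  have sub: "S \<subseteq> degrees u" "T \<subseteq> degrees v" and fin: "finite S" "finite T"
    and SG: "S \<subseteq> carrier G" and TG: "T \<subseteq> carrier G"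
  proof -
    show *: "S \<subseteq> degrees u" "T \<subseteq> degrees v"
      unfolding S_def T_def degrees_def using P.zero_closed by auto
    then show "finite S" "finite T" using finite_degrees u v finite_subset by blast+
    show "S \<subseteq> carrier G" "T \<subseteq> carrier G" unfolding S_def T_def by auto
  qed
  have ne: "{x \<in> carrier G. component w x \<notin> P} \<noteq> {}" if w: "w \<in> carrier R" "w \<notin> P" for w
  proof
    assume "{x \<in> carrier G. component w x \<notin> P} = {}"
    then have "(\<Oplus>x\<in>degrees w. component w x) \<in> P"
      using degrees_subset by (intro P.finsum_mem) blast
    then show False using sum_components w by simp
  qed
  have one: "\<one> \<notin> P" using P.one_imp_carrier P.I_notcarr by blast
  then have "u \<notin> P" "v \<notin> P" using P.I_l_closed P.I_r_closed u v uv by metis+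
  then have "S \<noteq> {}" "T \<noteq> {}" using ne u v unfolding S_def T_def by auto
  then obtain s t where s: "s \<in> S" "\<forall>x\<in>S. x = s \<or> lt x s" and t: "t \<in> T" "\<forall>y\<in>T. y = t \<or> lt y t"
    using O.finite_max fin SG TG by meson
  have stG: "s \<in> carrier G" "t \<in> carrier G" using s t SG TG by auto
  define h where "h x y =
    (if x \<otimes>\<^bsub>G\<^esub> y = s \<otimes>\<^bsub>G\<^esub> t then component u x \<otimes> component v y else \<zero>)" for x y
  have hc: "h x y \<in> carrier R" if "x \<in> carrier G" "y \<in> carrier G" for x y
    unfolding h_def using that u v component_carrier by simp
  \<comment> \<open>Either both factors are outside \<open>P\<close>, and then the degree is
    strictly smaller and \<open>h\<close> is zero, or one factor lies in \<open>P\<close>.\<close>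
  have mem: "h x y \<in> P" if xy: "x \<in> carrier G" "y \<in> carrier G" "x \<noteq> s \<or> y \<noteq> t" for x y
  proof (cases "x \<in> S \<and> y \<in> T")
    case True
    then have "lt (x \<otimes>\<^bsub>G\<^esub> y) (s \<otimes>\<^bsub>G\<^esub> t)"
      using xy stG s t by (intro O.mult_strict_mono) auto
    then have "x \<otimes>\<^bsub>G\<^esub> y \<noteq> s \<otimes>\<^bsub>G\<^esub> t" using O.irrefl stG by auto
    then show ?thesis unfolding h_def by simp
  next
    case False
    then have "component u x \<in> P \<or> component v y \<in> P" using xy unfolding S_def T_def by blast
    then show ?thesis
      unfolding h_def using P.I_l_closed P.I_r_closed component_carrier u v xy by auto
  qed
  have "component u s \<notin> P" "component v t \<notin> P" using s t unfolding S_def T_def by auto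
  \<comment> \<open>Here primality enters: a product of two components outside \<open>P\<close>
    stays outside \<open>P\<close>.\<close>
  then have lead: "h s t \<notin> P"
    unfolding h_def using P.I_prime component_carrier u v stG by auto
  have dG: "x \<in> carrier G" if "x \<in> degrees w" for x w using that degrees_subset by blast
  have "(\<Oplus>y\<in>degrees v. h s y) \<notin> P"
    using finite_degrees[OF v] sub t lead mem hc stG dG
    by (intro P.finsum_not_mem[of "degrees v" t]) auto
  moreover have "(\<Oplus>y\<in>degrees v. h x y) \<in> P" if "x \<in> carrier G" "x \<noteq> s" for x
    using that mem dG by (intro P.finsum_mem) auto
  ultimately have "(\<Oplus>x\<in>degrees u. \<Oplus>y\<in>degrees v. h x y) \<notin> P"
    using finite_degrees[OF u] sub s hc stG dG
    by (intro P.finsum_not_mem[of "degrees u" s]) (auto intro!: finsum_closed)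
  then have "component \<one> (s \<otimes>\<^bsub>G\<^esub> t) \<notin> P"
    using component_mult_expand[OF u v _ finite_degrees[OF u] _ _ finite_degrees[OF v], of "s \<otimes>\<^bsub>G\<^esub> t"]
      stG degrees_subset unfolding uv h_def by simp
  then have "s \<otimes>\<^bsub>G\<^esub> t = \<one>\<^bsub>G\<^esub>"
    using component_one[of "s \<otimes>\<^bsub>G\<^esub> t"] stG by (auto split: if_splits)
  then show thesis using that s t by blast
qed

text \<open>The largest degrees \<open>s\<close>, \<open>t\<close> and the smallest degrees
  \<open>s'\<close>, \<open>t'\<close> modulo \<open>P\<close> have the same product, the neutral
  element, so strict monotonicity forces \<open>s = s'\<close>. Hence only one component of
  \<open>u\<close> is outside \<open>P\<close>, and by \<open>u1\<close> it is the one in neutral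
  degree.\<close>

lemma invertible_component_mem_prime:
  assumes ord: "ordered_group_rel G lt" and P: "primeideal P R"
    and u: "u \<in> carrier R" and v: "v \<in> carrier R" and uv: "u \<otimes> v = \<one>"
    and u1: "component u \<one>\<^bsub>G\<^esub> \<notin> P" and x: "x \<in> carrier G" "x \<noteq> \<one>\<^bsub>G\<^esub>"
  shows "component u x \<in> P"
proof (rule ccontr)
  interpret O: ordered_group_rel G lt by fact
  let ?S = "{x \<in> carrier G. component u x \<notin> P}"
  let ?T = "{y \<in> carrier G. component v y \<notin> P}"
  assume "component u x \<notin> P"
  then have S: "x \<in> ?S" "\<one>\<^bsub>G\<^esub> \<in> ?S" using u1 x by auto
  obtain s t where st: "s \<in> ?S" "t \<in> ?T" "s \<otimes>\<^bsub>G\<^esub> t = \<one>\<^bsub>G\<^esub>"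
    and max: "\<forall>x\<in>?S. x = s \<or> lt x s" "\<forall>y\<in>?T. y = t \<or> lt y t"
    by (rule leading_degrees_mod_prime[OF ord P u v uv])
  obtain s' t' where st': "s' \<in> ?S" "t' \<in> ?T" "s' \<otimes>\<^bsub>G\<^esub> t' = \<one>\<^bsub>G\<^esub>"
    and min: "\<forall>x\<in>?S. x = s' \<or> lt s' x" "\<forall>y\<in>?T. y = t' \<or> lt t' y"
    by (rule leading_degrees_mod_prime[OF O.converse P u v uv])
  have "s' = s"
  proof (rule ccontr)
    assume "s' \<noteq> s"
    then have "lt (s' \<otimes>\<^bsub>G\<^esub> t') (s \<otimes>\<^bsub>G\<^esub> t)"
      using st st' max by (intro O.mult_strict_mono) auto
    then show False using st(3) st'(3) O.irrefl by simp
  qed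
  have "y = s" if "y \<in> ?S" for y
  proof -
    have "\<not> (lt y s \<and> lt s y)" using O.trans[of y s y] O.irrefl that st by auto
    then show ?thesis using max(1) min(1) that \<open>s' = s\<close> by blast
  qed
  then show False using S x by metis
qed

lemma power_mem_component:
  assumes "x \<in> carrier G" "a \<in> A x"
  shows "a [^] (n::nat) \<in> A (x [^]\<^bsub>G\<^esub> n)"
proof (induction n)
  case 0
  then show ?case using one_mem_component by simp
next
  case (Suc n)
  then show ?case using component_mult[OF _ assms(1) Suc assms(2)] assms(1) by simp
qed

end

section \<open>Shifting degrees and comparing the two radicals\<close>

text \<open>The powers of \<open>x\<close> are pairwise distinct by torsion-freeness, so infinitely
  many, and cannot all lie in \<open>S\<close>.\<close>

lemma (in group) exists_power_avoiding:
  assumes "torsion_free G" and x: "x \<in> carrier G" "x \<noteq> \<one>" and S: "finite S"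
  obtains k :: nat where "x [^] k \<notin> S"
proof -
  have le: "m = n" if mn: "m \<le> n" "x [^] m = x [^] n" for m n :: nat
  proof (rule ccontr)
    assume "m \<noteq> n"
    have "x [^] m \<otimes> x [^] (n - m) = x [^] m \<otimes> \<one>"
      using nat_pow_mult[OF x(1), of m "n - m"] mn x(1) by simp
    then have "x [^] (n - m) = \<one>" using x by (metis l_cancel nat_pow_closed one_closed)
    then show False using torsion_freeD[OF assms(1) x(1), of "n - m"] x(2) mn(1) \<open>m \<noteq> n\<close> by simp
  qed
  have "inj (\<lambda>k::nat. x [^] k)"
    by (rule injI) (metis le nat_le_linear)
  then have "\<not> range (\<lambda>k::nat. x [^] k) \<subseteq> S"
    using S finite_subset finite_imageD infinite_UNIV_nat by metis
  then show thesis using that by blast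
qed

lemma (in graded_ring) jacobson_radical_subset_nilradical:
  assumes "comm_group G" "torsion_free G" "cring R"
    and x: "x \<in> carrier G" "x \<noteq> \<one>\<^bsub>G\<^esub>" and aA: "a \<in> A x" and a: "non_zero_divisor R a"
  shows "jacobson_radical R \<subseteq> nilradical R"
proof
  interpret CG: comm_group G by fact
  interpret cring R by fact
  have ac: "a \<in> carrier R" using homogeneous_carrier x(1) aA .
  obtain lt where ord: "ordered_group_rel G lt"
    using CG.torsion_free_orderable[OF assms(2)] .
  fix f assume f: "f \<in> jacobson_radical R"
  have fc: "f \<in> carrier R" using f unfolding jacobson_radical_def by simp
  \<comment> \<open>Multiplication by \<open>a [^] k\<close> shifts each degree of \<open>f\<close>
    by the \<open>k\<close>-th power of \<open>x\<close>. A degree becomes neutral only if that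
    power is its inverse.\<close>
  obtain k :: nat where k: "x [^]\<^bsub>G\<^esub> k \<notin> (\<lambda>y. inv\<^bsub>G\<^esub> y) ` degrees f"
    using G.exists_power_avoiding[OF assms(2) x finite_imageI[OF finite_degrees[OF fc]]] .
  let ?b = "a [^] k"
  let ?h = "?b \<otimes> f"
  have b: "?b \<in> carrier R" "?b \<in> A (x [^]\<^bsub>G\<^esub> k)"
    using ac power_mem_component[OF x(1) aA] by auto
  have hc: "?h \<in> carrier R" using b fc by simp
  have "component ?h \<one>\<^bsub>G\<^esub> = \<zero>"
  proof -
    have c: "y \<in> carrier G" "component f y \<in> carrier R" if "y \<in> degrees f" for y
      using that degrees_subset component_carrier fc by blast+
    have "component (?b \<otimes> component f y) \<one>\<^bsub>G\<^esub> = \<zero>" if y: "y \<in> degrees f" for y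
    proof -
      have "?b \<otimes> component f y \<in> A (x [^]\<^bsub>G\<^esub> k \<otimes>\<^bsub>G\<^esub> y)"
        using component_mult b component_mem fc c[OF y] x by simp
      moreover have "x [^]\<^bsub>G\<^esub> k \<otimes>\<^bsub>G\<^esub> y \<noteq> \<one>\<^bsub>G\<^esub>"
        using k y x c[OF y] G.inv_equality[of "x [^]\<^bsub>G\<^esub> k" y]
        by (metis G.nat_pow_closed imageI)
      ultimately show ?thesis
        using component_homogeneous[of "x [^]\<^bsub>G\<^esub> k \<otimes>\<^bsub>G\<^esub> y" "\<one>\<^bsub>G\<^esub>"] x c[OF y] by auto
    qed
    then have "(\<Oplus>y\<in>degrees f. component (?b \<otimes> component f y) \<one>\<^bsub>G\<^esub>) = \<zero>"
      by (rule add.finprod_one_eqI)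
    moreover have "?h = (\<Oplus>y\<in>degrees f. ?b \<otimes> component f y)"
      using finsum_rdistr[OF finite_degrees[OF fc] b(1), of "component f"] c
        sum_components[OF fc] by auto
    ultimately show ?thesis
      using component_finsum[OF finite_degrees[OF fc], of "\<lambda>y. ?b \<otimes> component f y"] b c
      by simp
  qed
  let ?u = "\<one> \<oplus> ?h"
  have comp_u: "component ?u y = (if y = \<one>\<^bsub>G\<^esub> then \<one> else component ?h y)"
    if "y \<in> carrier G" for y
    using component_add[OF one_closed hc that] component_one[OF that]
      \<open>component ?h \<one>\<^bsub>G\<^esub> = \<zero>\<close> component_carrier[OF hc that] by auto
  obtain v where v: "v \<in> carrier R" "?u \<otimes> v = \<one>"
    using jacobson_one_plus_mult_invertible[OF f b(1)] .
  \<comment> \<open>The neutral component of \<open>?u\<close> is \<open>\<one>\<close>, which is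
    outside \<open>P\<close>. All other components of \<open>?u\<close> agree with those of
    \<open>?h\<close>, so each of these lies in \<open>P\<close>.\<close>
  have "?h \<in> P" if P: "primeideal P R" for P
  proof -
    interpret P: primeideal P R by fact
    have one: "\<one> \<notin> P" using P.one_imp_carrier P.I_notcarr by blast
    have "component ?h y \<in> P" if y: "y \<in> carrier G" for y
    proof (cases "y = \<one>\<^bsub>G\<^esub>")
      case True
      then show ?thesis using \<open>component ?h \<one>\<^bsub>G\<^esub> = \<zero>\<close> by simp
    next
      case False
      then show ?thesis
        using invertible_component_mem_prime[OF ord P _ v _ y False] hc comp_u y one by simp
    qed
    then have "(\<Oplus>y\<in>degrees ?h. component ?h y) \<in> P"
      using degrees_subset by (intro P.finsum_mem) blast
    then show ?thesis using sum_components[OF hc] by simp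
  qed
  then have "?h \<in> nilradical R" using exists_prime_not_containing[OF hc] by blast
  then obtain n :: nat where n: "n > 0" "?h [^] n = \<zero>" unfolding nilradical_def by blast
  \<comment> \<open>Commutativity separates the powers of \<open>a\<close> and \<open>f\<close> in
    \<open>?h [^] n\<close>, and the non-zero-divisor then cancels.\<close>
  then have "a [^] (k * n) \<otimes> f [^] n = \<zero>"
    using ac fc by (simp add: nat_pow_distrib nat_pow_pow)
  then have "f [^] n = \<zero>" using power_mult_eq_zero_imp[OF a] fc by simp
  then show "f \<in> nilradical R" using n fc unfolding nilradical_def by blast
qed

theorem theorem7p17:
  fixes G :: "('g, 'm) monoid_scheme"
    and R :: "('r, 'n) ring_scheme"
    and A :: "'g \<Rightarrow> 'r set"
  assumes "comm_group G"
    and "torsion_free G"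
    and "cring R"
    and "graded_ring G R A"
    and "\<exists>x a. x \<noteq> \<one>\<^bsub>G\<^esub> \<and> homogeneous_of_degree G R A x a \<and> non_zero_divisor R a"
  shows "quasi_jacobson R"
proof -
  interpret graded_ring G R A by fact
  interpret cring R by fact
  obtain x a where "x \<in> carrier G" "x \<noteq> \<one>\<^bsub>G\<^esub>" "a \<in> A x" "non_zero_divisor R a"
    using assms(5) unfolding homogeneous_of_degree_def by blast
  then have "jacobson_radical R \<subseteq> nilradical R"
    by (rule jacobson_radical_subset_nilradical[OF assms(1-3)])
  then show ?thesis
    unfolding quasi_jacobson_def using nilradical_subset_jacobson_radical by blast
qed

end
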